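(* Let $p$ be a prime and let $S_\Delta$ be the set of forms of discriminant $\Delta$. If an integer $n$ is represented by all forms $Q\in S_\Delta$ and $p$ is represented by some form $Q_i\in S_\Delta$, then $np$ is represented by all forms $Q\in S_\Delta$.
   Context: Conventions: "form" means an integral, binary, positive definite, primitive, reduced quadratic form $Q(x,y)=ax^2+bxy+cy^2$ with $a,b,c\in\mathbb{Z}$. Primitive means $\gcd(a,b,c)=1$; reduced means $|b|\leq a\leq c$, and $b\geq 0$ if $|b|=a$ or $a=c$. The discriminant is $\Delta=b^2-4ac$, which is negative for positive definite forms. $Q$ represents an integer $m$ if $Q(x,y)=m$ for some $x,y\in\mathbb{Z}$. $S_\Delta$ is a finite set. *)

theory Defs
  imports "HOL-Computational_Algebra.Primes"
begin

text \<open>The triple \<open>(a, b, c)\<close> stands for the binary quadratic form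
  \<open>a x\<^sup>2 + b x y + c y\<^sup>2\<close> with integer coefficients.\<close>

type_synonym bqf = "int \<times> int \<times> int"

fun bqf_eval :: "bqf \<Rightarrow> int \<Rightarrow> int \<Rightarrow> int" where
  "bqf_eval (a, b, c) x y = a * x\<^sup>2 + b * x * y + c * y\<^sup>2"

fun discriminant :: "bqf \<Rightarrow> int" where
  "discriminant (a, b, c) = b\<^sup>2 - 4 * a * c"

definition positive_definite :: "bqf \<Rightarrow> bool" where
  "positive_definite Q \<longleftrightarrow> (\<forall>x y. (x, y) \<noteq> (0, 0) \<longrightarrow> bqf_eval Q x y > 0)"

fun primitive :: "bqf \<Rightarrow> bool" where
  "primitive (a, b, c) \<longleftrightarrow> Gcd {a, b, c} = 1"

fun reduced :: "bqf \<Rightarrow> bool" where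
  "reduced (a, b, c) \<longleftrightarrow>
     \<bar>b\<bar> \<le> a \<and> a \<le> c \<and> (\<bar>b\<bar> = a \<or> a = c \<longrightarrow> b \<ge> 0)"

definition represents :: "bqf \<Rightarrow> int \<Rightarrow> bool" where
  "represents Q m \<longleftrightarrow> (\<exists>x y. bqf_eval Q x y = m)"

text \<open>Positive definiteness is required of integer arguments only. With \<open>reduced\<close> this is
  the usual notion: \<open>a > 0\<close> and \<open>\<bar>b\<bar> \<le> a \<le> c\<close> make the discriminant negative. In particular
  the set below is empty unless \<open>\<Delta> < 0\<close>.\<close>

definition forms_of_discriminant :: "int \<Rightarrow> bqf set" where
  "forms_of_discriminant \<Delta> =
     {Q. positive_definite Q \<and> primitive Q \<and> reduced Q \<and> discriminant Q = \<Delta>}"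

end

theory Submission
  imports Defs
begin

text \<open>In terms of Gauss composition the reason is short: if \<open>P\<close> is the class of a form that
  represents \<open>p\<close> and \<open>Q\<close> is any class, then \<open>R = Q P\<^sup>-\<^sup>1\<close> represents \<open>n\<close> by hypothesis, so
  \<open>Q = R P\<close> represents \<open>n p\<close>. Since \<open>p\<close> is prime, \<open>R\<close> can be written down without composition.

  A form that represents \<open>p\<close> is properly equivalent to one with leading coefficient \<open>p\<close>, say
  \<open>(p, B, C)\<close>. By primitivity \<open>Q\<close> is properly equivalent to a form whose leading coefficient
  \<open>A\<close> is prime to \<open>p\<close>, and a translation then makes the middle coefficient
  \<open>\<beta> \<equiv> B (mod 2 p)\<close>. Comparing the discriminants shows that \<open>p\<close> divides the last coefficient,
  so \<open>Q\<close> is equivalent to some \<open>(A, \<beta>, p \<gamma>)\<close>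
  (\<open>equivalent_form_with_multiple_of_prime\<close>). The form \<open>R = (p A, \<beta>, \<gamma>)\<close> has the same
  discriminant, and
  \<open>p R(x, y) = A (p x)\<^sup>2 + \<beta> (p x) y + p \<gamma> y\<^sup>2\<close>,
  so that \<open>Q\<close> represents \<open>n p\<close> as soon as \<open>R\<close> represents \<open>n\<close>.

  The hypothesis on \<open>n\<close> is applied to the reduced form equivalent to \<open>R\<close>
  (\<open>exists_reduced_form\<close>). For this \<open>R\<close> must be primitive. The only prime in doubt is \<open>p\<close>,
  and it would divide \<open>R\<close> only if it divided \<open>(p, B, C)\<close>, which is primitive.\<close>

section \<open>Proper equivalence of forms\<close>

text \<open>The form \<open>Q(x X + u Y, y X + v Y)\<close> in the variables \<open>X\<close>, \<open>Y\<close>.\<close>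

fun substitute :: "bqf \<Rightarrow> int \<Rightarrow> int \<Rightarrow> int \<Rightarrow> int \<Rightarrow> bqf" where
  "substitute (a, b, c) x u y v =
     (a * x\<^sup>2 + b * x * y + c * y\<^sup>2,
      2 * a * x * u + b * (x * v + u * y) + 2 * c * y * v,
      a * u\<^sup>2 + b * u * v + c * v\<^sup>2)"

definition equivalent :: "bqf \<Rightarrow> bqf \<Rightarrow> bool" where
  "equivalent Q Q' \<longleftrightarrow> (\<exists>x u y v. x * v - u * y = 1 \<and> Q' = substitute Q x u y v)"

lemma bqf_eval_substitute:
  "bqf_eval (substitute Q x u y v) X Y = bqf_eval Q (x * X + u * Y) (y * X + v * Y)"
  by (cases Q) (simp add: algebra_simps power2_eq_square)

lemma discriminant_substitute:
  "discriminant (substitute Q x u y v) = (x * v - u * y)\<^sup>2 * discriminant Q"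
  by (cases Q) (simp add: algebra_simps power2_eq_square)

lemma substitute_substitute:
  "substitute (substitute Q x u y v) x' u' y' v' =
     substitute Q (x * x' + u * y') (x * u' + u * v') (y * x' + v * y') (y * u' + v * v')"
  by (cases Q) (simp add: algebra_simps power2_eq_square)

lemma substitute_identity: "substitute Q 1 0 0 1 = Q"
  by (cases Q) simp

lemma equivalent_trans:
  assumes "equivalent Q Q'" "equivalent Q' Q''"
  shows "equivalent Q Q''"
proof -
  obtain x u y v where M: "x * v - u * y = 1" "Q' = substitute Q x u y v"
    using assms(1) unfolding equivalent_def by blast
  obtain x' u' y' v' where N: "x' * v' - u' * y' = 1" "Q'' = substitute Q' x' u' y' v'"
    using assms(2) unfolding equivalent_def by blast
  have "(x * x' + u * y') * (y * u' + v * v') - (x * u' + u * v') * (y * x' + v * y')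
      = (x * v - u * y) * (x' * v' - u' * y')"
    by (simp add: algebra_simps)
  then show ?thesis
    unfolding equivalent_def using M N by (metis mult_1 substitute_substitute)
qed

lemma equivalent_refl: "equivalent Q Q"
  unfolding equivalent_def using substitute_identity[of Q]
  by (metis diff_zero mult_1 mult_zero_left)

lemma equivalent_sym:
  assumes "equivalent Q Q'"
  shows "equivalent Q' Q"
proof -
  obtain x u y v where M: "x * v - u * y = 1" "Q' = substitute Q x u y v"
    using assms unfolding equivalent_def by blast
  have "substitute Q' v (- u) (- y) x = Q"
    unfolding M(2) substitute_substitute using M(1)
    by (simp add: substitute_identity algebra_simps)
  moreover have "v * x - (- u) * (- y) = 1"
    using M(1) by (simp add: algebra_simps)
  ultimately show ?thesis
    unfolding equivalent_def by metis
qed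

lemma equivalent_translate: "equivalent (a, b, c) (a, b + 2 * a * k, a * k\<^sup>2 + b * k + c)"
  unfolding equivalent_def
  by (rule exI[of _ 1], rule exI[of _ k], rule exI[of _ 0], rule exI[of _ 1])
     (simp add: algebra_simps)

lemma equivalent_swap: "equivalent (a, b, c) (c, - b, a)"
  unfolding equivalent_def
  by (rule exI[of _ 0], rule exI[of _ "-1"], rule exI[of _ 1], rule exI[of _ 0]) simp

lemma equivalent_discriminant: "equivalent Q Q' \<Longrightarrow> discriminant Q' = discriminant Q"
  unfolding equivalent_def by (auto simp: discriminant_substitute)

lemma equivalent_represents:
  assumes "equivalent Q Q'" "represents Q' m"
  shows "represents Q m"
  using assms unfolding equivalent_def represents_def by (metis bqf_eval_substitute)

lemma equivalent_positive_definite: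
  assumes "equivalent Q Q'" "positive_definite Q"
  shows "positive_definite Q'"
  unfolding positive_definite_def
proof (intro allI impI)
  fix X Y :: int
  assume nz: "(X, Y) \<noteq> (0, 0)"
  obtain x u y v where M: "x * v - u * y = 1" "Q' = substitute Q x u y v"
    using assms(1) unfolding equivalent_def by blast
  have "X = (x * v - u * y) * X" "Y = (x * v - u * y) * Y"
    using M(1) by simp_all
  \<comment> \<open>Cramer's rule: an invertible substitution sends only the zero vector to zero.\<close>
  then have "X = v * (x * X + u * Y) - u * (y * X + v * Y)"
      "Y = x * (y * X + v * Y) - y * (x * X + u * Y)"
    by (simp_all add: algebra_simps)
  then have "(x * X + u * Y, y * X + v * Y) \<noteq> (0, 0)"
    using nz by (metis Pair_inject diff_zero mult_zero_right)
  then show "bqf_eval Q' X Y > 0"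
    using assms(2) unfolding M(2) bqf_eval_substitute positive_definite_def by blast
qed

lemma primitive_iff_no_prime_divisor:
  "primitive (a, b, c) \<longleftrightarrow> \<not> (\<exists>q. prime q \<and> q dvd a \<and> q dvd b \<and> q dvd c)"
proof
  assume "primitive (a, b, c)"
  then have G: "Gcd {a, b, c} = 1" by simp
  show "\<not> (\<exists>q. prime q \<and> q dvd a \<and> q dvd b \<and> q dvd c)"
  proof
    assume "\<exists>q. prime q \<and> q dvd a \<and> q dvd b \<and> q dvd c"
    then obtain q where q: "prime q" "q dvd a" "q dvd b" "q dvd c" by blast
    then have "q dvd Gcd {a, b, c}" by (intro Gcd_greatest) auto
    with G q(1) show False by (simp add: not_prime_unit)
  qed
next
  assume no: "\<not> (\<exists>q. prime q \<and> q dvd a \<and> q dvd b \<and> q dvd c)"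
  have div: "Gcd {a, b, c} dvd a" "Gcd {a, b, c} dvd b" "Gcd {a, b, c} dvd c"
    by (rule Gcd_dvd, simp)+
  have "is_unit (Gcd {a, b, c})"
  proof (rule ccontr)
    assume nu: "\<not> is_unit (Gcd {a, b, c})"
    have "\<exists>q. prime q \<and> q dvd Gcd {a, b, c}"
    proof (cases "Gcd {a, b, c} = 0")
      case True
      then show ?thesis using two_is_prime_nat by (metis dvd_0_right prime_nat_int_transfer)
    next
      case False
      then show ?thesis using nu by (metis prime_divisor_exists)
    qed
    with no div show False by (meson dvd_trans)
  qed
  then show "primitive (a, b, c)" by simp
qed

lemma equivalent_primitive:
  assumes "equivalent Q Q'" "primitive Q"
  shows "primitive Q'"
proof -
  obtain a b c where Q': "Q' = (a, b, c)" by (cases Q')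
  obtain a' b' c' where Q: "Q = (a', b', c')" by (cases Q)
  \<comment> \<open>A common divisor of the coefficients survives every substitution, in particular the
    inverse one that leads back from \<open>Q'\<close> to \<open>Q\<close>.\<close>
  obtain x u y v where "Q = substitute Q' x u y v"
    using equivalent_sym[OF assms(1)] unfolding equivalent_def by blast
  then have "d dvd a' \<and> d dvd b' \<and> d dvd c'" if "d dvd a" "d dvd b" "d dvd c" for d
    using that unfolding Q Q' by simp
  then show ?thesis
    using assms(2) unfolding Q Q' primitive_iff_no_prime_divisor by blast
qed

section \<open>Reduction\<close>

lemma exists_centred_residue:
  fixes a b :: int
  assumes "a > 0"
  obtains k where "- a < b + 2 * a * k" "b + 2 * a * k \<le> a"
proof -
  define k where "k = - ((b + a - 1) div (2 * a))"
  have "b + 2 * a * k = (b + a - 1) mod (2 * a) - (a - 1)"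
    unfolding k_def by (simp add: minus_mult_div_eq_mod[symmetric])
  moreover have "0 \<le> (b + a - 1) mod (2 * a)" "(b + a - 1) mod (2 * a) < 2 * a"
    using assms by simp_all
  ultimately show thesis by (intro that[of k]) linarith+
qed

lemma positive_definite_coeffs:
  assumes "positive_definite (a, b, c)"
  shows "a > 0" "c > 0"
proof -
  have "bqf_eval (a, b, c) 1 0 > 0" "bqf_eval (a, b, c) 0 1 > 0"
    using assms unfolding positive_definite_def by (metis Pair_inject zero_neq_one)+
  then show "a > 0" "c > 0" by simp_all
qed

text \<open>A translation brings \<open>b\<close> into the interval from \<open>- a\<close> (excluded) to \<open>a\<close>. If then
  \<open>c < a\<close>, exchanging the variables lowers the leading coefficient, which stays positive,
  so the process ends. If \<open>a = c\<close> and \<open>b < 0\<close>, one further exchange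
  corrects the sign of \<open>b\<close>.\<close>

lemma exists_reduced_form:
  assumes "positive_definite Q"
  shows "\<exists>Q'. equivalent Q Q' \<and> reduced Q'"
  using assms
proof (induction "nat (fst Q)" arbitrary: Q rule: less_induct)
  case less
  obtain a b\<^sub>0 c\<^sub>0 where Q: "Q = (a, b\<^sub>0, c\<^sub>0)" by (cases Q)
  have a: "a > 0" using less.prems positive_definite_coeffs unfolding Q by blast
  obtain k where k: "- a < b\<^sub>0 + 2 * a * k" "b\<^sub>0 + 2 * a * k \<le> a"
    using exists_centred_residue[OF a] .
  define b where "b = b\<^sub>0 + 2 * a * k"
  define c where "c = a * k\<^sup>2 + b\<^sub>0 * k + c\<^sub>0"
  have e: "equivalent Q (a, b, c)"
    unfolding Q b_def c_def by (rule equivalent_translate)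
  have e': "equivalent Q (c, - b, a)"
    using e equivalent_swap equivalent_trans by blast
  have b: "- a < b" "b \<le> a" using k unfolding b_def .
  consider "c < a" | "a < c \<or> a = c \<and> b \<ge> 0" | "a = c" "b < 0" by linarith
  then show ?case
  proof cases
    case 1
    have pd: "positive_definite (c, - b, a)"
      using e' less.prems equivalent_positive_definite by blast
    have "nat (fst (c, - b, a)) < nat (fst Q)"
      using 1 a by (simp add: Q)
    from less.hyps[OF this pd] e' equivalent_trans show ?thesis by blast
  next
    case 2
    then have "reduced (a, b, c)" using b by auto
    with e show ?thesis by blast
  next
    case 3
    then have "reduced (c, - b, a)" using b by auto
    with e' show ?thesis by blast
  qed
qed

lemma represents_of_all_reduced:
  assumes "positive_definite Q" "primitive Q"
    and "\<forall>Q'\<in>forms_of_discriminant (discriminant Q). represents Q' n"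
  shows "represents Q n"
proof -
  obtain Q' where Q': "equivalent Q Q'" "reduced Q'"
    using exists_reduced_form[OF assms(1)] by blast
  then have "Q' \<in> forms_of_discriminant (discriminant Q)"
    unfolding forms_of_discriminant_def
    using assms equivalent_positive_definite equivalent_primitive equivalent_discriminant
    by blast
  then show ?thesis
    using assms(3) Q'(1) equivalent_represents by blast
qed

section \<open>Prescribing coefficients\<close>

text \<open>A prime is not divisible by the square of a non-unit, so a vector at which it is attained
  has coprime entries and is the first column of a matrix of determinant 1.\<close>

lemma equivalent_form_with_prime_leading:
  assumes "prime p" "represents Q p"
  obtains B C where "equivalent Q (p, B, C)"
proof -
  obtain a b c where Q: "Q = (a, b, c)" by (cases Q)
  obtain x y where xy: "a * x\<^sup>2 + b * x * y + c * y\<^sup>2 = p"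
    using assms(2) unfolding Q represents_def by auto
  have "gcd x y * gcd x y dvd a * (x * x) + b * (x * y) + c * (y * y)"
    by (intro dvd_add dvd_mult mult_dvd_mono gcd_dvd1 gcd_dvd2)
  then have sq: "gcd x y * gcd x y dvd p"
    using xy by (simp add: power2_eq_square mult.assoc)
  have "is_unit (gcd x y)"
  proof (rule ccontr)
    assume nu: "\<not> is_unit (gcd x y)"
    have p: "p \<noteq> 0" "\<not> is_unit p" using assms(1) by (auto simp: not_prime_unit)
    obtain r where r: "p = gcd x y * gcd x y * r" using sq by (auto elim: dvdE)
    have "irreducible p" using assms(1) by (metis prime_elem_imp_irreducible prime_imp_prime_elem)
    then have "is_unit (gcd x y) \<or> is_unit (gcd x y * r)"
      using r by (metis irreducibleD mult.assoc)
    with nu show False by (metis dvd_mult_left)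
  qed
  then have "gcd x y = 1" by simp
  then obtain v u' where "v * x + u' * y = 1" using bezout_int[of x y] by auto
  then have "x * v - (- u') * y = 1" by (simp add: algebra_simps)
  then have "equivalent Q (substitute Q x (- u') y v)"
    unfolding equivalent_def by blast
  then show thesis using that xy unfolding Q by simp
qed

text \<open>A prime dividing the three values \<open>Q(1, 0) = a\<close>, \<open>Q(0, 1) = c\<close> and
  \<open>Q(1, 1) = a + b + c\<close> would divide \<open>b\<close> as well.\<close>

lemma equivalent_form_with_leading_prime_to:
  assumes "prime p" "primitive Q"
  obtains A b c where "equivalent Q (A, b, c)" "\<not> p dvd A"
proof -
  obtain a b c where Q: "Q = (a, b, c)" by (cases Q)
  have "\<not> p dvd a \<or> \<not> p dvd c \<or> \<not> p dvd a + b + c"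
    using assms unfolding Q primitive_iff_no_prime_divisor
    by (metis dvd_add_left_iff dvd_add_right_iff)
  moreover have "equivalent Q (a + b + c, - (b + 2 * a), a)"
    using equivalent_trans[OF equivalent_translate[of a b c 1] equivalent_swap]
    unfolding Q by simp
  moreover have "equivalent Q (a, b, c)" "equivalent Q (c, - b, a)"
    unfolding Q by (rule equivalent_refl, rule equivalent_swap)
  ultimately show thesis using that by blast
qed

text \<open>Equal discriminants force \<open>b \<equiv> B (mod 2)\<close>, so the congruence
  \<open>b + 2 A k \<equiv> B (mod 2 p)\<close> amounts to \<open>A k \<equiv> (B - b) / 2 (mod p)\<close> and is solvable
  because \<open>A\<close> is prime to \<open>p\<close>. For the form \<open>(A, \<beta>, \<delta>)\<close> so obtained,
  \<open>4 A \<delta> = \<beta>\<^sup>2 - \<Delta>\<close> is congruent to \<open>B\<^sup>2 - \<Delta> = 4 p C\<close>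
  modulo \<open>4 p\<close>, whence \<open>p\<close> divides \<open>\<delta>\<close>. Working modulo \<open>2 p\<close> treats \<open>p = 2\<close> like the
  other primes.\<close>

lemma equivalent_form_with_multiple_of_prime:
  assumes p: "prime p" and "primitive Q" and disc: "discriminant Q = discriminant (p, B, C)"
  obtains A \<beta> \<gamma> where "equivalent Q (A, \<beta>, p * \<gamma>)" "2 * p dvd \<beta> - B"
proof -
  obtain A b c where e: "equivalent Q (A, b, c)" and A: "\<not> p dvd A"
    using equivalent_form_with_leading_prime_to[OF assms(1,2)] .
  have d: "b\<^sup>2 - 4 * A * c = B\<^sup>2 - 4 * p * C"
    using equivalent_discriminant[OF e] disc by simp
  then have "b\<^sup>2 - B\<^sup>2 = 2 * (2 * A * c - 2 * p * C)" by simp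
  then have "even (b\<^sup>2 - B\<^sup>2)" by (metis dvd_triv_left)
  then have "even (B - b)" by simp
  then obtain h where h: "B - b = 2 * h" by (rule evenE)
  have "coprime A p" using p A by (metis coprime_commute prime_imp_coprime)
  then obtain s t where st: "s * A + t * p = 1"
    using bezout_int[of A p] by (auto simp: coprime_iff_gcd_eq_1)
  define \<beta> where "\<beta> = b + 2 * A * (s * h)"
  define \<delta> where "\<delta> = A * (s * h)\<^sup>2 + b * (s * h) + c"
  have e': "equivalent Q (A, \<beta>, \<delta>)"
    unfolding \<beta>_def \<delta>_def using e equivalent_translate equivalent_trans by blast
  have "\<beta> - B = 2 * h * (s * A) - 2 * h" using h unfolding \<beta>_def by (simp add: algebra_simps)
  also have "\<dots> = 2 * h * (s * A - 1)" by (simp add: algebra_simps)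
  also have "\<dots> = 2 * p * (- h * t)" using st by (simp add: algebra_simps flip: st)
  finally have m: "\<beta> = B + 2 * p * (- h * t)" by simp
  have "\<beta>\<^sup>2 - 4 * A * \<delta> = B\<^sup>2 - 4 * p * C"
    using equivalent_discriminant[OF e'] disc by simp
  then have "4 * (A * \<delta>) = 4 * (p * (C + (- h * t) * B + p * (- h * t)\<^sup>2))"
    unfolding m by (simp add: algebra_simps power2_eq_square)
  then have "p dvd A * \<delta>" by simp
  then have "p dvd \<delta>" using p A by (metis prime_dvd_mult_iff)
  then obtain \<gamma> where "\<delta> = p * \<gamma>" by (auto elim: dvdE)
  with e' m show thesis by (intro that) auto
qed

section \<open>Multiplication by a represented prime\<close>

text \<open>If \<open>p\<close> divides \<open>\<beta>\<close> and \<open>\<gamma>\<close>, then it divides \<open>B\<close>, so \<open>\<beta> + B\<close> like \<open>\<beta> - B\<close> is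
  divisible by \<open>2 p\<close> and \<open>\<beta>\<^sup>2 \<equiv> B\<^sup>2 (mod 4 p\<^sup>2)\<close>. Hence
  \<open>4 p C \<equiv> 4 p A \<gamma> \<equiv> 0 (mod 4 p\<^sup>2)\<close>, and \<open>p\<close> divides all of \<open>(p, B, C)\<close>.\<close>

lemma primitive_move_prime:
  assumes p: "prime p"
    and prim: "primitive (A, \<beta>, p * \<gamma>)" "primitive (p, B, C)"
    and disc: "discriminant (A, \<beta>, p * \<gamma>) = discriminant (p, B, C)"
    and cong: "2 * p dvd \<beta> - B"
  shows "primitive (p * A, \<beta>, \<gamma>)"
  unfolding primitive_iff_no_prime_divisor
proof
  assume "\<exists>q. prime q \<and> q dvd p * A \<and> q dvd \<beta> \<and> q dvd \<gamma>"
  then obtain q where q: "prime q" "q dvd p * A" "q dvd \<beta>" "q dvd \<gamma>" by blast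
  have "\<not> q dvd A"
    using q prim(1) unfolding primitive_iff_no_prime_divisor by (meson dvd_mult)
  then have "q dvd p" using q by (metis prime_dvd_mult_iff)
  then have "q = p" using q(1) p by (metis primes_dvd_imp_eq)
  with q have dvd: "p dvd \<beta>" "p dvd \<gamma>" by simp_all
  obtain m where m: "\<beta> - B = 2 * p * m" using cong by (auto elim: dvdE)
  obtain r where r: "\<beta> = p * r" using dvd(1) by (auto elim: dvdE)
  obtain s where s: "\<gamma> = p * s" using dvd(2) by (auto elim: dvdE)
  have B: "B = p * (r - 2 * m)" using m r by (simp add: algebra_simps)
  have "(4 * p) * C = (4 * p) * (p * (m\<^sup>2 - m * r + A * s))"
    using disc unfolding B r s by (simp add: algebra_simps power2_eq_square)
  then have "C = p * (m\<^sup>2 - m * r + A * s)" using p by simp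
  with B prim(2) p show False
    unfolding primitive_iff_no_prime_divisor by (metis dvd_refl dvd_triv_left)
qed

lemma bqf_eval_move_prime:
  "bqf_eval (A, \<beta>, p * \<gamma>) (p * x) y = p * bqf_eval (p * A, \<beta>, \<gamma>) x y"
  by (simp add: algebra_simps power2_eq_square)

lemma positive_definite_move_prime:
  fixes p :: int
  assumes "p > 0" "positive_definite (A, \<beta>, p * \<gamma>)"
  shows "positive_definite (p * A, \<beta>, \<gamma>)"
  unfolding positive_definite_def
proof (intro allI impI)
  fix x y :: int
  assume "(x, y) \<noteq> (0, 0)"
  then have "(p * x, y) \<noteq> (0, 0)" using assms(1) by simp
  then have "p * bqf_eval (p * A, \<beta>, \<gamma>) x y > 0"
    using assms(2) unfolding positive_definite_def by (metis bqf_eval_move_prime)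
  then show "bqf_eval (p * A, \<beta>, \<gamma>) x y > 0"
    using assms(1) by (metis zero_less_mult_pos)
qed

theorem theorem3:
  fixes p n \<Delta> :: int
  assumes "prime p"
    and "\<forall>Q\<in>forms_of_discriminant \<Delta>. represents Q n"
    and "\<exists>Q\<in>forms_of_discriminant \<Delta>. represents Q p"
  shows "\<forall>Q\<in>forms_of_discriminant \<Delta>. represents Q (n * p)"
proof
  fix Q assume "Q \<in> forms_of_discriminant \<Delta>"
  then have Q: "positive_definite Q" "primitive Q" "discriminant Q = \<Delta>"
    unfolding forms_of_discriminant_def by auto
  obtain P where P: "primitive P" "discriminant P = \<Delta>" "represents P p"
    using assms(3) unfolding forms_of_discriminant_def by blast
  obtain B C where "equivalent P (p, B, C)"
    using equivalent_form_with_prime_leading[OF assms(1) P(3)] .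
  then have BC: "primitive (p, B, C)" "discriminant (p, B, C) = \<Delta>"
    using P equivalent_primitive equivalent_discriminant by blast+
  obtain A \<beta> \<gamma> where e: "equivalent Q (A, \<beta>, p * \<gamma>)" and cong: "2 * p dvd \<beta> - B"
    using equivalent_form_with_multiple_of_prime[OF assms(1) Q(2), of B C] Q(3) BC(2) by metis
  have d: "discriminant (A, \<beta>, p * \<gamma>) = \<Delta>"
    using equivalent_discriminant[OF e] Q(3) by simp
  have "primitive (p * A, \<beta>, \<gamma>)"
    using primitive_move_prime[OF assms(1) equivalent_primitive[OF e Q(2)] BC(1) _ cong] d BC(2)
    by simp
  moreover have "positive_definite (p * A, \<beta>, \<gamma>)"
    using positive_definite_move_prime equivalent_positive_definite[OF e Q(1)]
      prime_gt_0_int[OF assms(1)] by blast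
  moreover have "discriminant (p * A, \<beta>, \<gamma>) = \<Delta>"
    using d by (simp add: algebra_simps)
  ultimately have "represents (p * A, \<beta>, \<gamma>) n"
    using represents_of_all_reduced assms(2) by blast
  then obtain x y where "bqf_eval (p * A, \<beta>, \<gamma>) x y = n"
    unfolding represents_def by blast
  then have "bqf_eval (A, \<beta>, p * \<gamma>) (p * x) y = n * p"
    by (metis bqf_eval_move_prime mult.commute)
  then show "represents Q (n * p)"
    using e equivalent_represents unfolding represents_def by metis
qed

end
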